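(* Let $\mathbb F$ be a subfield of $\mathbb R$ and let $\alpha\in\mathbb R$ be transcendental over $\mathbb F$. Then for every sign pattern matrix $A$, $\mathrm{mr}_{\mathbb F(\alpha)}(A)=\mathrm{mr}_{\mathbb F}(A)$.
   Context: A sign pattern matrix is a matrix with entries in $\{+,-,0\}$. For a real matrix $B$, $\mathrm{sgn}(B)$ is the sign pattern matrix obtained by replacing each positive (resp. negative, zero) entry of $B$ by $+$ (resp. $-$, $0$). For a sign pattern matrix $A$ and a subfield $\mathbb F$ of $\mathbb R$, $Q_{\mathbb F}(A)=\{B : B \text{ has entries in } \mathbb F,\ \mathrm{sgn}(B)=A\}$ and $\mathrm{mr}_{\mathbb F}(A)=\min_{B\in Q_{\mathbb F}(A)}\mathrm{rank}(B)$. $\mathbb F(\alpha)$ denotes the subfield of $\mathbb R$ generated by $\mathbb F$ and $\alpha$. *)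

theory Defs
  imports "HOL-Analysis.Analysis" "HOL-Computational_Algebra.Polynomial"
begin

datatype sign_entry = Plus | Minus | Zero

definition sign_of :: "real \<Rightarrow> sign_entry" where
  "sign_of x = (if x > 0 then Plus else if x < 0 then Minus else Zero)"

definition sgn_pattern :: "real ^ 'n ^ 'm \<Rightarrow> sign_entry ^ 'n ^ 'm" where
  "sgn_pattern B = (\<chi> i j. sign_of (B $ i $ j))"

(* Since inverse 0 = 0, closure under inverse needs no side condition. *)
definition real_subfield :: "real set \<Rightarrow> bool" where
  "real_subfield F \<longleftrightarrow>
     0 \<in> F \<and> 1 \<in> F \<and>
     (\<forall>x\<in>F. \<forall>y\<in>F. x + y \<in> F) \<and> (\<forall>x\<in>F. - x \<in> F) \<and>
     (\<forall>x\<in>F. \<forall>y\<in>F. x * y \<in> F) \<and> (\<forall>x\<in>F. inverse x \<in> F)"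

definition transcendental_over :: "real set \<Rightarrow> real \<Rightarrow> bool" where
  "transcendental_over F a \<longleftrightarrow>
     \<not> (\<exists>p :: real poly. p \<noteq> 0 \<and> (\<forall>i. coeff p i \<in> F) \<and> poly p a = 0)"

definition field_adjoin :: "real set \<Rightarrow> real \<Rightarrow> real set" where
  "field_adjoin F a = \<Inter>{K. real_subfield K \<and> F \<subseteq> K \<and> a \<in> K}"

definition qual_class :: "real set \<Rightarrow> sign_entry ^ 'n ^ 'm \<Rightarrow> (real ^ 'n ^ 'm) set" where
  "qual_class F A = {B. (\<forall>i j. B $ i $ j \<in> F) \<and> sgn_pattern B = A}"

(* The rank is taken over the reals; by invariance of rank under field extension it is
   also the rank over F.  For a subfield F the infimum is a minimum: see min_rank_attained. *)
definition min_rank :: "real set \<Rightarrow> sign_entry ^ 'n ^ 'm \<Rightarrow> nat" where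
  "min_rank F A = (INF B \<in> qual_class F A. rank B)"

lemma qual_class_nonempty:
  assumes "real_subfield F"
  shows "qual_class F A \<noteq> {}"
proof -
  define B :: "real ^ 'a ^ 'b" where
    "B = (\<chi> i j. case A $ i $ j of Plus \<Rightarrow> 1 | Minus \<Rightarrow> - 1 | Zero \<Rightarrow> 0)"
  have "0 \<in> F" "1 \<in> F" "- 1 \<in> F"
    using assms by (auto simp: real_subfield_def)
  then have "B \<in> qual_class F A"
    by (auto simp: qual_class_def B_def sgn_pattern_def sign_of_def vec_eq_iff
        split: sign_entry.split)
  then show ?thesis by blast
qed

lemma min_rank_attained:
  assumes "real_subfield F"
  shows "\<exists>B \<in> qual_class F A. rank B = min_rank F A \<and> (\<forall>C \<in> qual_class F A. rank B \<le> rank C)"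
proof -
  have "min_rank F A \<in> rank ` qual_class F A"
    unfolding min_rank_def using qual_class_nonempty[OF assms] by (intro Inf_nat_def1) blast
  moreover have "min_rank F A \<le> rank C" if "C \<in> qual_class F A" for C
    unfolding min_rank_def using that by (intro cINF_lower) auto
  ultimately show ?thesis by fastforce
qed

lemma field_adjoin_subfield: "real_subfield (field_adjoin F a)"
  unfolding field_adjoin_def real_subfield_def by auto

end

theory Submission
  imports Defs
begin

text \<open>
  After scaling by a positive common denominator, a minimum-rank matrix over \<open>F(\<alpha>)\<close> has entries
  \<open>p\<^sub>i\<^sub>j(\<alpha>)\<close> with \<open>p\<^sub>i\<^sub>j \<in> F[X]\<close>. Replace \<open>\<alpha>\<close> by a rational \<open>x\<close> close to it. An entry vanishing
  at \<open>\<alpha>\<close> is the zero polynomial by transcendence, so it still vanishes at \<open>x\<close>; the other entries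
  keep their sign by continuity. Fraction-free Gaussian elimination on the polynomial matrix
  shows that the rank does not increase either: its finitely many pivots are nonzero
  at \<open>\<alpha>\<close>, hence also near \<open>\<alpha>\<close>.
\<close>

section \<open>Polynomials with coefficients in a subfield\<close>

text \<open>This is F[X]. As \<open>F\<close> is a set and not a type, its polynomials are real
  polynomials with restricted coefficients.\<close>

definition polys_over :: "real set \<Rightarrow> real poly set" where
  "polys_over F = {p. \<forall>i. coeff p i \<in> F}"

lemma real_subfieldD:
  assumes "real_subfield F"
  shows "0 \<in> F" "1 \<in> F" "x \<in> F \<Longrightarrow> y \<in> F \<Longrightarrow> x + y \<in> F" "x \<in> F \<Longrightarrow> - x \<in> F"
    "x \<in> F \<Longrightarrow> y \<in> F \<Longrightarrow> x * y \<in> F" "x \<in> F \<Longrightarrow> inverse x \<in> F"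
  using assms by (auto simp: real_subfield_def)

lemma real_subfield_sum:
  assumes "real_subfield F" and "\<And>i. i \<in> I \<Longrightarrow> f i \<in> F"
  shows "sum f I \<in> F"
  using assms(2) by (induction I rule: infinite_finite_induct)
    (auto intro: real_subfieldD[OF assms(1)])

lemma real_subfield_power: "real_subfield F \<Longrightarrow> x \<in> F \<Longrightarrow> x ^ n \<in> F"
  by (induction n) (auto intro: real_subfieldD)

text \<open>Since the rationals are dense in the reals, this supplies points of \<open>F\<close>
  arbitrarily close to \<alpha>.\<close>

lemma Rats_subset_real_subfield:
  assumes F: "real_subfield F"
  shows "\<rat> \<subseteq> F"
proof
  fix x :: real assume "x \<in> \<rat>"
  then obtain a b :: int where x: "x = of_int a / of_int b"
    by (auto elim: Rats_cases')
  have nat: "of_nat n \<in> F" for n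
    by (induction n) (auto intro: real_subfieldD[OF F])
  have int: "of_int k \<in> F" for k
    by (cases k rule: int_cases2) (auto intro: nat real_subfieldD(4)[OF F])
  show "x \<in> F"
    unfolding x divide_inverse by (intro real_subfieldD[OF F] int)
qed

lemma polys_over_add: "real_subfield F \<Longrightarrow> p \<in> polys_over F \<Longrightarrow> q \<in> polys_over F \<Longrightarrow> p + q \<in> polys_over F"
  by (auto simp: polys_over_def intro: real_subfieldD)

lemma polys_over_uminus: "real_subfield F \<Longrightarrow> p \<in> polys_over F \<Longrightarrow> - p \<in> polys_over F"
  by (auto simp: polys_over_def intro: real_subfieldD)

lemma polys_over_diff: "real_subfield F \<Longrightarrow> p \<in> polys_over F \<Longrightarrow> q \<in> polys_over F \<Longrightarrow> p - q \<in> polys_over F"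
  using polys_over_add[of F p "- q"] polys_over_uminus[of F q] by simp

lemma polys_over_mult: "real_subfield F \<Longrightarrow> p \<in> polys_over F \<Longrightarrow> q \<in> polys_over F \<Longrightarrow> p * q \<in> polys_over F"
  by (auto simp: polys_over_def coeff_mult intro!: real_subfield_sum real_subfieldD(5))

lemma polys_over_pCons: "c \<in> F \<Longrightarrow> p \<in> polys_over F \<Longrightarrow> pCons c p \<in> polys_over F"
  by (auto simp: polys_over_def coeff_pCons split: nat.split)

lemma polys_over_0: "real_subfield F \<Longrightarrow> 0 \<in> polys_over F"
  by (auto simp: polys_over_def intro: real_subfieldD)

lemma polys_over_1: "real_subfield F \<Longrightarrow> 1 \<in> polys_over F"
  using polys_over_pCons[of 1 F 0] by (simp add: polys_over_0 real_subfieldD flip: one_pCons)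

lemma poly_in_subfield:
  assumes "real_subfield F" "p \<in> polys_over F" "x \<in> F"
  shows "poly p x \<in> F"
  using assms by (auto simp: poly_altdef polys_over_def
      intro!: real_subfield_sum real_subfieldD(5) real_subfield_power)

lemma transcendental_poly_eq_0:
  "transcendental_over F a \<Longrightarrow> p \<in> polys_over F \<Longrightarrow> poly p a = 0 \<Longrightarrow> p = 0"
  by (auto simp: transcendental_over_def polys_over_def)

section \<open>Elements of F(\<alpha>) as fractions\<close>

text \<open>The values \<open>b\<close> of such fractions form a subfield \<open>K\<close>
  containing \<open>F\<close> and \<open>a\<close>, so \<open>K\<close> is one of the fields
  intersected in \<open>field_adjoin\<close>. Denominators are kept positive so that clearing them
  preserves signs.\<close>

lemma field_adjoin_fraction:
  assumes F: "real_subfield F" and b: "b \<in> field_adjoin F a"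
  obtains p q where "p \<in> polys_over F" "q \<in> polys_over F" "poly q a > 0" "b * poly q a = poly p a"
proof -
  define K where "K = {b. \<exists>p\<in>polys_over F. \<exists>q\<in>polys_over F. poly q a > 0 \<and> b * poly q a = poly p a}"
  have KI: "b \<in> K" if "p \<in> polys_over F" "q \<in> polys_over F" "poly q a > 0" "b * poly q a = poly p a" for b p q
    using that by (auto simp: K_def)
  note closed = polys_over_add[OF F] polys_over_uminus[OF F] polys_over_mult[OF F]
    polys_over_0[OF F] polys_over_1[OF F] polys_over_pCons
  have FK: "x \<in> K" if "x \<in> F" for x
    by (rule KI[of "[:x:]" 1]) (auto intro!: closed that)
  have aK: "a \<in> K"
    by (rule KI[of "[:0, 1:]" 1]) (auto intro!: closed real_subfieldD[OF F])
  have "real_subfield K"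
    unfolding real_subfield_def
  proof (intro conjI ballI)
    show "0 \<in> K" "1 \<in> K"
      by (auto intro!: FK real_subfieldD[OF F])
  next
    fix x y assume "x \<in> K" "y \<in> K"
    then obtain p q r s where *: "p \<in> polys_over F" "q \<in> polys_over F" "poly q a > 0" "x * poly q a = poly p a"
      "r \<in> polys_over F" "s \<in> polys_over F" "poly s a > 0" "y * poly s a = poly r a"
      by (auto simp: K_def)
    have "(x + y) * poly (q * s) a = poly (p * s + r * q) a"
      by (simp add: algebra_simps flip: *(4,8))
    then show "x + y \<in> K"
      using * by (intro KI[of "p * s + r * q" "q * s"]) (auto intro!: closed)
    have "(x * y) * poly (q * s) a = poly (p * r) a"
      by (simp add: algebra_simps flip: *(4,8))
    then show "x * y \<in> K"
      using * by (intro KI[of "p * r" "q * s"]) (auto intro!: closed)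
  next
    fix x assume xK: "x \<in> K"
    then obtain p q where *: "p \<in> polys_over F" "q \<in> polys_over F" "poly q a > 0" "x * poly q a = poly p a"
      by (auto simp: K_def)
    then show "- x \<in> K"
      by (intro KI[of "- p" q]) (auto intro!: closed)
    show "inverse x \<in> K"
    proof (cases "x = 0")
      case True
      then show ?thesis using xK by simp
    next
      case False
      then have "poly p a \<noteq> 0"
        using * by (metis less_irrefl mult_eq_0_iff)
      \<comment> \<open>The numerator \<open>p\<close> may be negative at \<open>a\<close>, so the
        inverse q/p is written as pq/p^2.\<close>
      then have "poly (p * p) a > 0"
        by (simp flip: power2_eq_square)
      moreover have "inverse x * poly (p * p) a = poly (p * q) a"
        using False by (simp add: field_simps flip: *(4))
      ultimately show ?thesis
        using * by (intro KI[of "p * q" "p * p"]) (auto intro!: closed)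
    qed
  qed
  then have "field_adjoin F a \<subseteq> K"
    unfolding field_adjoin_def using FK aK by blast
  then show thesis
    using b that by (auto simp: K_def)
qed

text \<open>The product of the individual denominators works. A single positive factor for all
  entries lets a whole matrix be scaled without changing its rank or its signs.\<close>

lemma field_adjoin_common_denominator:
  assumes F: "real_subfield F" and "finite X" and "X \<subseteq> field_adjoin F a"
  shows "\<exists>q\<in>polys_over F. poly q a > 0 \<and> (\<forall>b\<in>X. \<exists>p\<in>polys_over F. b * poly q a = poly p a)"
  using assms(2,3)
proof (induction X rule: finite_induct)
  case empty
  then show ?case
    by (intro bexI[of _ 1] polys_over_1 F) auto
next
  case (insert b X)
  then obtain q where q: "q \<in> polys_over F" "poly q a > 0"
    "\<And>c. c \<in> X \<Longrightarrow> \<exists>p\<in>polys_over F. c * poly q a = poly p a"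
    by auto
  obtain p s where ps: "p \<in> polys_over F" "s \<in> polys_over F" "poly s a > 0" "b * poly s a = poly p a"
    using field_adjoin_fraction[OF F] insert.prems by blast
  have "\<exists>t\<in>polys_over F. c * poly (q * s) a = poly t a" if c: "c \<in> insert b X" for c
  proof (cases "c = b")
    case True
    have "b * poly (q * s) a = poly (p * q) a"
      by (simp add: algebra_simps flip: ps(4))
    then show ?thesis
      using True ps q polys_over_mult[OF F] by blast
  next
    case False
    then obtain r where r: "r \<in> polys_over F" "c * poly q a = poly r a"
      using q(3) c by blast
    have "c * poly (q * s) a = poly (r * s) a"
      by (simp flip: r(2))
    then show ?thesis
      using r ps polys_over_mult[OF F] by blast
  qed
  then show ?case
    using q ps by (intro bexI[of _ "q * s"] polys_over_mult F) auto
qed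

section \<open>Rank and signs of a polynomial matrix near a transcendental point\<close>

definition poly_mat :: "('m \<Rightarrow> 'n \<Rightarrow> real poly) \<Rightarrow> real \<Rightarrow> real ^ 'n ^ 'm" where
  "poly_mat P x = (\<chi> i j. poly (P i j) x)"

lemma poly_mat_nth [simp]: "poly_mat P x $ i $ j = poly (P i j) x"
  by (simp add: poly_mat_def)

lemma rank_eq_dim_range: "rank (B :: real ^ 'n ^ 'm) = dim (range (($) B))"
proof -
  have "rows B = range (($) B)"
    by (auto simp: rows_def row_def)
  then show ?thesis
    by (simp add: row_rank_def)
qed

lemma tendsto_poly_nhds: "(poly p \<longlongrightarrow> poly p a) (nhds a)" for a :: real
  using poly_isCont[of a p] by (simp add: isCont_def tendsto_at_iff_tendsto_nhds)

text \<open>Induction on the rank at \<open>a\<close>: eliminating with one pivot lowers the rank at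
  \<open>a\<close> by at least one, and lowers the rank at a nearby \<open>x\<close> by at most
  one.\<close>

lemma eventually_rank_poly_mat_le:
  fixes P :: "'m::finite \<Rightarrow> 'n::finite \<Rightarrow> real poly"
  assumes F: "real_subfield F" and a: "transcendental_over F a"
    and P: "\<And>i j. P i j \<in> polys_over F"
  shows "\<forall>\<^sub>F x in nhds a. rank (poly_mat P x) \<le> rank (poly_mat P a)"
  using P
proof (induction "rank (poly_mat P a)" arbitrary: P rule: less_induct)
  case less
  show ?case
  proof (cases "\<forall>i j. poly (P i j) a = 0")
    case True
    then have "P i j = 0" for i j
      using transcendental_poly_eq_0[OF a less.prems] by blast
    then have "poly_mat P x = 0" for x
      by (simp add: vec_eq_iff)
    then show ?thesis by simp
  next
    case False
    then obtain k l where kl: "poly (P k l) a \<noteq> 0" by blast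
    \<comment> \<open>One elimination step with pivot \<open>P k l\<close>, cross-multiplied so that
      the entries stay polynomials over \<open>F\<close>. Row \<open>k\<close> and column
      \<open>l\<close> of \<open>W\<close> vanish identically.\<close>
    define W where "W i j = P k l * P i j - P i l * P k j" for i j
    have row_W: "poly_mat W x $ i = poly (P k l) x *\<^sub>R poly_mat P x $ i - poly (P i l) x *\<^sub>R poly_mat P x $ k" for x i
      by (simp add: vec_eq_iff W_def)
    have W: "W i j \<in> polys_over F" for i j
      unfolding W_def by (intro polys_over_diff polys_over_mult F less.prems)
    have "rank (poly_mat W a) < rank (poly_mat P a)"
    proof -
      let ?R = "range (($) (poly_mat P a))" and ?S = "range (($) (poly_mat W a))"
      have sub: "span ?S \<subseteq> span ?R"
        by (intro span_minimal) (auto simp: row_W intro!: span_diff intro: span_scale span_base)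
      \<comment> \<open>Coordinate \<open>l\<close> separates the pivot row from the row space of
        \<open>W\<close>, so the inclusion of row spaces is strict.\<close>
      have "span ?S \<subseteq> {v. v $ l = 0}"
        by (intro span_minimal) (auto simp: W_def subspace_def algebra_simps)
      then have "poly_mat P a $ k \<notin> span ?S"
        using kl by auto
      then have "span ?S \<subset> span ?R"
        using sub by (metis psubsetI rangeI span_base)
      then show ?thesis
        unfolding rank_eq_dim_range by (rule dim_psubset)
    qed
    from less.hyps[OF this W] tendsto_imp_eventually_ne[OF tendsto_poly_nhds kl]
    show ?thesis
    proof eventually_elim
      case (elim x)
      let ?R = "range (($) (poly_mat P x))" and ?S = "range (($) (poly_mat W x))"
      \<comment> \<open>Where the pivot does not vanish, the elimination can be undone: the rows of
        \<open>P\<close> come from those of \<open>W\<close> together with the single pivot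
        row.\<close>
      have "poly_mat P x $ i \<in> span (insert (poly_mat P x $ k) ?S)" for i
      proof -
        have "poly_mat P x $ i = inverse (poly (P k l) x) *\<^sub>R
            (poly_mat W x $ i + poly (P i l) x *\<^sub>R poly_mat P x $ k)"
          using elim(2) by (simp add: row_W)
        then show ?thesis
          by (metis insertI1 insertI2 rangeI span_add span_base span_scale)
      qed
      then have "dim ?R \<le> dim (insert (poly_mat P x $ k) ?S)"
        by (metis dim_span dim_subset image_subsetI)
      also have "\<dots> \<le> dim ?S + 1"
        by (simp add: dim_insert)
      finally show ?case
        using elim(1) \<open>rank (poly_mat W a) < rank (poly_mat P a)\<close>
        unfolding rank_eq_dim_range by linarith
    qed
  qed
qed

text \<open>Strict signs persist by continuity. Vanishing is not an open condition, but by
  transcendence it occurs at \<open>a\<close> only for the zero polynomial.\<close>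

lemma eventually_sign_of_poly:
  assumes "transcendental_over F a" and "p \<in> polys_over F"
  shows "\<forall>\<^sub>F x in nhds a. sign_of (poly p x) = sign_of (poly p a)"
proof -
  consider "poly p a > 0" | "poly p a < 0" | "p = 0"
    using transcendental_poly_eq_0[OF assms] by linarith
  then show ?thesis
  proof cases
    case 1
    show ?thesis
      using order_tendstoD(1)[OF tendsto_poly_nhds 1] by eventually_elim (use 1 in \<open>simp add: sign_of_def\<close>)
  next
    case 2
    show ?thesis
      using order_tendstoD(2)[OF tendsto_poly_nhds 2] by eventually_elim (use 2 in \<open>simp add: sign_of_def\<close>)
  qed simp
qed

lemma ex_qual_class_rank_le:
  fixes A :: "sign_entry ^ 'n ^ 'm"
  assumes F: "real_subfield F" and a: "transcendental_over F a"
    and B: "B \<in> qual_class (field_adjoin F a) A"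
  shows "\<exists>C\<in>qual_class F A. rank C \<le> rank B"
proof -
  have "finite (range (\<lambda>(i, j). B $ i $ j))" "range (\<lambda>(i, j). B $ i $ j) \<subseteq> field_adjoin F a"
    using B by (auto simp: qual_class_def)
  from field_adjoin_common_denominator[OF F this]
  obtain q where q: "poly q a > 0" "\<And>i j. \<exists>p\<in>polys_over F. B $ i $ j * poly q a = poly p a"
    by fastforce
  then obtain P where P: "\<And>i j. P i j \<in> polys_over F" "\<And>i j. B $ i $ j * poly q a = poly (P i j) a"
    by metis
  have sign: "sign_of (poly (P i j) a) = A $ i $ j" for i j
    using B q(1) by (auto simp: qual_class_def sgn_pattern_def sign_of_def
        zero_less_mult_iff mult_less_0_iff simp flip: P(2))
  \<comment> \<open>Clearing denominators rescales every row of \<open>B\<close> by the same number,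
    so no new directions enter the row space.\<close>
  have "poly_mat P a $ i = poly q a *\<^sub>R B $ i" for i
    by (simp add: vec_eq_iff flip: P(2))
  then have "range (($) (poly_mat P a)) \<subseteq> span (range (($) B))"
    by (auto intro: span_scale span_base)
  then have rank: "rank (poly_mat P a) \<le> rank B"
    unfolding rank_eq_dim_range by (metis dim_span dim_subset)
  \<comment> \<open>There are finitely many entries, so one neighbourhood serves them all.\<close>
  have "\<forall>\<^sub>F x in nhds a. \<forall>i j. sign_of (poly (P i j) x) = sign_of (poly (P i j) a)"
    by (intro eventually_all_finite eventually_sign_of_poly[OF a] P)
  with eventually_rank_poly_mat_le[OF F a P(1)]
  have "\<forall>\<^sub>F x in nhds a. rank (poly_mat P x) \<le> rank (poly_mat P a) \<and>
      (\<forall>i j. sign_of (poly (P i j) x) = sign_of (poly (P i j) a))"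
    by (rule eventually_conj)
  then obtain e where e: "e > 0" "\<And>x. dist x a < e \<Longrightarrow> rank (poly_mat P x) \<le> rank (poly_mat P a) \<and>
      (\<forall>i j. sign_of (poly (P i j) x) = sign_of (poly (P i j) a))"
    unfolding eventually_nhds_metric by blast
  obtain x where x: "x \<in> \<rat>" "a < x" "x < a + e"
    using Rats_dense_in_real[of a "a + e"] e(1) by auto
  then have "dist x a < e"
    by (simp add: dist_real_def)
  note ex = e(2)[OF this]
  have "x \<in> F"
    using Rats_subset_real_subfield[OF F] x by blast
  then have "poly_mat P x \<in> qual_class F A"
    using ex sign by (auto simp: qual_class_def sgn_pattern_def vec_eq_iff intro: poly_in_subfield[OF F P(1)])
  then show ?thesis
    using ex rank order_trans by blast
qed

theorem theorem3:
  fixes F :: "real set" and \<alpha> :: real and A :: "sign_entry ^ 'n ^ 'm"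
  assumes "real_subfield F" and "transcendental_over F \<alpha>"
  shows "min_rank (field_adjoin F \<alpha>) A = min_rank F A"
proof (rule antisym)
  \<comment> \<open>A larger field admits more matrices, which can only lower the minimum.\<close>
  have "qual_class F A \<subseteq> qual_class (field_adjoin F \<alpha>) A"
    unfolding qual_class_def field_adjoin_def by auto
  then show "min_rank (field_adjoin F \<alpha>) A \<le> min_rank F A"
    unfolding min_rank_def
    by (intro cINF_superset_mono qual_class_nonempty assms) auto
  \<comment> \<open>Conversely, a minimizer over F(\<alpha>) is specialized to a matrix over
    \<open>F\<close> of no larger rank.\<close>
  obtain B where B: "B \<in> qual_class (field_adjoin F \<alpha>) A" "rank B = min_rank (field_adjoin F \<alpha>) A"
    using min_rank_attained[OF field_adjoin_subfield] by blast
  obtain C where C: "C \<in> qual_class F A" "rank C \<le> rank B"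
    using ex_qual_class_rank_le[OF assms B(1)] by blast
  have "min_rank F A \<le> rank C"
    unfolding min_rank_def using C(1) by (intro cINF_lower) auto
  then show "min_rank F A \<le> min_rank (field_adjoin F \<alpha>) A"
    using C(2) B(2) by simp
qed

end
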